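(* For $\mu,\lambda>0$, let $X_{\mu,\lambda}$ be an inverse Gaussian random variable with parameters $\mu$ and $\lambda$, and let $Z$ be a standard normal random variable. Then, for all $\mu,\lambda>0$, $$P\left\{|X_{\mu,\lambda}-E[X_{\mu,\lambda}]|\le \sqrt{\mathrm{Var}(X_{\mu,\lambda})}\right\}>P\{|Z|\le 1\}\approx 0.6827,$$ and $$\inf_{\mu>0,\,\lambda>0}P\left\{|X_{\mu,\lambda}-E[X_{\mu,\lambda}]|\le \sqrt{\mathrm{Var}(X_{\mu,\lambda})}\right\}=P\{|Z|\le 1\}.$$
   Context: An inverse Gaussian (Wald) random variable with mean $\mu>0$ and shape parameter $\lambda>0$ has density $f_{\mu,\lambda}(x)=\sqrt{\frac{\lambda}{2\pi x^3}}\exp\left(-\frac{\lambda(x-\mu)^2}{2\mu^2x}\right)$ for $x>0$ (and $0$ for $x\le 0$). The symbol $\approx$ means equality after rounding to the number of decimals displayed. *)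

theory Defs
  imports "HOL-Probability.Probability"
begin

definition inverse_gaussian_density :: "real \<Rightarrow> real \<Rightarrow> real \<Rightarrow> real" where
  "inverse_gaussian_density \<mu> lam x =
     (if x > 0
      then sqrt (lam / (2 * pi * x ^ 3)) * exp (- (lam * (x - \<mu>)\<^sup>2 / (2 * \<mu>\<^sup>2 * x)))
      else 0)"

definition round_decimals :: "nat \<Rightarrow> real \<Rightarrow> real" where
  "round_decimals d x = of_int (round (10 ^ d * x)) / 10 ^ d"

end

theory Submission
  imports Defs "HOL-Real_Asymp.Real_Asymp"
begin

text \<open>After standardization the probability depends only on \<open>s = sqrt (\<mu> / lam)\<close>. For \<open>s \<le> 2 / 3\<close> the
  standardized density, symmetrized about 0, exceeds the normal density pointwise on \<open>[-1, 1]\<close>: by AM-GM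
  this reduces to an inequality for \<open>ln (1 - s\<^sup>2 z\<^sup>2)\<close>. For \<open>s \<ge> 2 / 3\<close> both tails are bounded by normal tails
  through the substitution \<open>w = z / sqrt (1 + s z)\<close>, and the bounds have total mass below 0.31. The infimum
  is approached as \<open>s\<close> tends to 0.\<close>

section \<open>The standard normal distribution function\<close>

text \<open>Symmetrization is forced: to first order in \<open>s\<close>, \<open>ig_std s z\<close>
  is the normal density times \<open>1 + s * (z^3 - 3 * z) / 2\<close>, which is less than 1 for
  \<open>0 < z \<le> 1\<close>; this odd term cancels only on averaging over \<open>z\<close> and
  \<open>- z\<close>. Even the average fails as \<open>s\<close> reaches 1, where the support ends
  at -1 and the average at \<open>z = 1\<close> has dropped below the normal density. This is why a
  second regime is needed. The threshold 2/3 lies just inside the range of the pointwise argument,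
  which needs \<open>u + u^2 < 2 / 3\<close> for \<open>u = s^2 * z^2\<close>; beyond it the two
  tails are small enough for crude numerical bounds. The substitution alone does not give the
  distribution function exactly: that has a second term with the factor
  \<open>exp (2 / s^2)\<close>. Bounding the Jacobian discrepancy \<open>1 + s * z / 2\<close> from
  below on each tail avoids this term. The total mass of the density is never computed. It equals 1
  because a random variable with that density is given, and mean and variance are derived from
  it.\<close>

abbreviation std_normal_cdf :: "real \<Rightarrow> real" where
  "std_normal_cdf \<equiv> cdf std_normal_distribution"

lemma isCont_std_normal_density [continuous_intros]: "isCont std_normal_density x"
  unfolding std_normal_density_def by (intro continuous_intros) auto

lemma continuous_on_std_normal_density: "continuous_on A std_normal_density"
  by (simp add: continuous_at_imp_continuous_on isCont_std_normal_density)

lemma std_normal_density_uminus: "std_normal_density (- x) = std_normal_density x"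
  by (simp add: std_normal_density_def)

lemma std_normal_density_le: "\<bar>y\<bar> \<le> \<bar>x\<bar> \<Longrightarrow> std_normal_density x \<le> std_normal_density y"
  by (simp add: std_normal_density_def divide_simps abs_le_square_iff)

lemma DERIV_std_normal_density:
  "(std_normal_density has_real_derivative (- x * std_normal_density x)) (at x)"
  unfolding std_normal_density_def
  by (auto intro!: derivative_eq_intros simp: field_simps power2_eq_square)

lemma measure_std_normal_distribution:
  assumes "A \<in> sets borel"
  shows "measure std_normal_distribution A = (\<integral>x. indicator A x * std_normal_density x \<partial>lborel)"
proof -
  have "measure std_normal_distribution A = enn2real (\<integral>\<^sup>+x. ennreal (indicator A x * std_normal_density x) \<partial>lborel)"
    using assms by (simp add: measure_def emeasure_density mult.commute indicator_mult_ennreal)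
  also have "\<dots> = (\<integral>x. indicator A x * std_normal_density x \<partial>lborel)"
    using assms by (intro integral_eq_nn_integral[symmetric]) auto
  finally show ?thesis .
qed

lemma std_normal_cdf_diff:
  assumes "a \<le> b"
  shows "std_normal_cdf b - std_normal_cdf a = integral {a..b} std_normal_density"
proof -
  interpret real_distribution std_normal_distribution by (rule real_dist_normal_dist)
  show ?thesis
  proof (cases "a = b")
    case False
    then have "std_normal_cdf b - std_normal_cdf a = measure std_normal_distribution {a<..b}"
      using assms by (intro cdf_diff_eq) auto
    also have "\<dots> = (\<integral>x. indicator {a<..b} x * std_normal_density x \<partial>lborel)"
      by (rule measure_std_normal_distribution) auto
    also have "\<dots> = (\<integral>x. indicator {a..b} x *\<^sub>R std_normal_density x \<partial>lborel)"
      using AE_lborel_singleton[of a]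
      by (intro integral_cong_AE) (auto split: split_indicator)
    also have "\<dots> = integral {a..b} std_normal_density"
      using borel_integrable_atLeastAtMost'[OF continuous_on_std_normal_density, of a b]
      by (subst set_borel_integral_eq_integral(2)[symmetric])
        (auto simp: set_lebesgue_integral_def)
    finally show ?thesis .
  qed auto
qed

text \<open>Near \<open>x\<close> the distribution function is a constant plus the integral from
  \<open>x - 1\<close>, a base point strictly to the left, so the fundamental theorem gives a
  two-sided derivative.\<close>

lemma DERIV_std_normal_cdf:
  "(std_normal_cdf has_real_derivative std_normal_density x) (at x)"
proof -
  have "((\<lambda>u. integral {x - 1..u} std_normal_density) has_real_derivative std_normal_density x)
      (at x within {x - 1..x + 1})"
    by (rule integral_has_real_derivative) (auto simp: continuous_on_std_normal_density)
  then have "((\<lambda>u. integral {x - 1..u} std_normal_density) has_real_derivative std_normal_density x) (at x)"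
    by (simp add: at_within_Icc_at)
  then have "((\<lambda>u. std_normal_cdf (x - 1) + integral {x - 1..u} std_normal_density)
      has_real_derivative std_normal_density x) (at x)"
    by (auto intro!: derivative_eq_intros)
  moreover have "\<forall>\<^sub>F u in nhds x. std_normal_cdf u = std_normal_cdf (x - 1) + integral {x - 1..u} std_normal_density"
    using eventually_nhds_in_open[of "{x - 1<..}" x]
    by (auto elim!: eventually_mono simp: std_normal_cdf_diff[symmetric])
  ultimately show ?thesis
    by (subst DERIV_cong_ev[OF refl _ refl])
qed

lemma std_normal_cdf_at_top: "(std_normal_cdf \<longlongrightarrow> 1) at_top"
  and std_normal_cdf_at_bot: "(std_normal_cdf \<longlongrightarrow> 0) at_bot"
proof -
  interpret real_distribution std_normal_distribution by (rule real_dist_normal_dist)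
  show "(std_normal_cdf \<longlongrightarrow> 1) at_top" "(std_normal_cdf \<longlongrightarrow> 0) at_bot"
    by (rule cdf_lim_at_top_prob cdf_lim_at_bot)+
qed

text \<open>Evenness of the density makes \<open>std_normal_cdf x + std_normal_cdf (- x)\<close>
  constant; its limit at infinity is 1.\<close>

lemma std_normal_cdf_uminus: "std_normal_cdf (- x) = 1 - std_normal_cdf x"
proof -
  let ?f = "\<lambda>x. std_normal_cdf x + std_normal_cdf (- x)"
  have "(?f has_real_derivative 0) (at x)" for x
    by (auto intro!: derivative_eq_intros DERIV_std_normal_cdf
        DERIV_chain2[where f = std_normal_cdf, OF DERIV_std_normal_cdf]
        simp: std_normal_density_uminus)
  then have const: "?f y = ?f x" for y
    by (intro DERIV_isconst_all) auto
  have "(?f \<longlongrightarrow> 1 + 0) at_top"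
    by (intro tendsto_add std_normal_cdf_at_top
        filterlim_compose[OF std_normal_cdf_at_bot filterlim_uminus_at_bot_at_top])
  then have "((\<lambda>_. ?f x) \<longlongrightarrow> 1 + 0) (at_top :: real filter)"
    by (subst (asm) const)
  then show ?thesis
    by (simp add: tendsto_const_iff)
qed

lemma std_normal_cdf_0: "std_normal_cdf 0 = 1 / 2"
  using std_normal_cdf_uminus[of 0] by simp

lemma std_normal_cdf_mono: "x \<le> y \<Longrightarrow> std_normal_cdf x \<le> std_normal_cdf y"
  by (rule DERIV_nonneg_imp_nondecreasing) (auto intro: DERIV_std_normal_cdf)

section \<open>Taylor bounds for the normal distribution function\<close>

text \<open>Termwise antiderivative, vanishing at 0, of the first \<open>n\<close> terms of the
  series of \<open>exp (- x^2 / 2)\<close>; the factor \<open>1 / sqrt (2 * pi)\<close> is left out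
  to keep the values rational.\<close>

definition std_normal_taylor :: "nat \<Rightarrow> real \<Rightarrow> real" where
  "std_normal_taylor n x = (\<Sum>k<n. (-1) ^ k * x ^ (2 * k + 1) / (2 ^ k * fact k * real (2 * k + 1)))"

lemma DERIV_std_normal_taylor:
  "(std_normal_taylor n has_real_derivative (\<Sum>k<n. (- x\<^sup>2 / 2) ^ k / fact k)) (at x)"
proof -
  have "((\<lambda>x. (-1) ^ k * x ^ (2 * k + 1) / (2 ^ k * fact k * real (2 * k + 1))) has_real_derivative
      (- x\<^sup>2 / 2) ^ k / fact k) (at x)" for k
  proof -
    have "((\<lambda>x. (-1) ^ k * x ^ (2 * k + 1) / (2 ^ k * fact k * real (2 * k + 1))) has_real_derivative
        (-1) ^ k * (real (2 * k + 1) * x ^ (2 * k)) / (2 ^ k * fact k * real (2 * k + 1))) (at x)"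
      using DERIV_pow[of "2 * k + 1" x]
      by (intro DERIV_cdivide DERIV_cmult) simp
    also have "(-1) ^ k * (real (2 * k + 1) * x ^ (2 * k)) / (2 ^ k * fact k * real (2 * k + 1))
        = (-1) ^ k * (x ^ (2 * k)) / (2 ^ k * fact k)"
      by (simp del: of_nat_add of_nat_mult of_nat_Suc)
    also have "\<dots> = (- x\<^sup>2 / 2) ^ k / fact k"
      by (simp add: power_mult power_divide power_minus[of "x\<^sup>2 / 2"])
    finally show ?thesis .
  qed
  then show ?thesis
    unfolding std_normal_taylor_def[abs_def] by (intro DERIV_sum) auto
qed

text \<open>Both sides agree at 0, so comparing derivatives suffices. The Lagrange remainder of the
  exponential has the sign of \<open>(- t^2 / 2) ^ n\<close>, hence is nonnegative for even
  \<open>n\<close>; odd \<open>n\<close> gives the matching upper bound.\<close>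

lemma std_normal_cdf_ge_taylor:
  assumes "x \<ge> 0" "even n"
  shows "std_normal_cdf x \<ge> 1 / 2 + std_normal_taylor n x / sqrt (2 * pi)"
proof -
  let ?D = "\<lambda>x. std_normal_cdf x - std_normal_taylor n x / sqrt (2 * pi)"
  have "?D 0 \<le> ?D x"
  proof (rule DERIV_nonneg_imp_nondecreasing[OF assms(1)])
    fix t :: real
    obtain u where u: "exp (- t\<^sup>2 / 2) =
        (\<Sum>m<n. (- t\<^sup>2 / 2) ^ m / fact m) + exp u / fact n * (- t\<^sup>2 / 2) ^ n"
      using Maclaurin_exp_le[of "- t\<^sup>2 / 2" n] by blast
    have "exp u / fact n * (- t\<^sup>2 / 2) ^ n \<ge> 0"
      using assms(2) by (intro mult_nonneg_nonneg zero_le_even_power) auto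
    then have "(\<Sum>m<n. (- t\<^sup>2 / 2) ^ m / fact m) / sqrt (2 * pi) \<le> exp (- t\<^sup>2 / 2) / sqrt (2 * pi)"
      using u by (intro divide_right_mono) auto
    then have "std_normal_density t - (\<Sum>m<n. (- t\<^sup>2 / 2) ^ m / fact m) / sqrt (2 * pi) \<ge> 0"
      by (simp add: std_normal_density_def)
    then show "\<exists>y. (?D has_real_derivative y) (at t) \<and> 0 \<le> y"
      using DERIV_diff[OF DERIV_std_normal_cdf DERIV_cdivide[OF DERIV_std_normal_taylor]] by blast
  qed
  then show ?thesis
    by (simp add: std_normal_cdf_0 std_normal_taylor_def)
qed

lemma std_normal_cdf_le_taylor:
  assumes "x \<ge> 0" "odd n"
  shows "std_normal_cdf x \<le> 1 / 2 + std_normal_taylor n x / sqrt (2 * pi)"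
proof -
  let ?D = "\<lambda>x. std_normal_taylor n x / sqrt (2 * pi) - std_normal_cdf x"
  have "?D 0 \<le> ?D x"
  proof (rule DERIV_nonneg_imp_nondecreasing[OF assms(1)])
    fix t :: real
    obtain u where u: "exp (- t\<^sup>2 / 2) =
        (\<Sum>m<n. (- t\<^sup>2 / 2) ^ m / fact m) + exp u / fact n * (- t\<^sup>2 / 2) ^ n"
      using Maclaurin_exp_le[of "- t\<^sup>2 / 2" n] by blast
    have "exp u / fact n * (- t\<^sup>2 / 2) ^ n \<le> 0"
      using assms(2) by (intro mult_nonneg_nonpos) (auto simp: power_le_zero_eq)
    then have "(\<Sum>m<n. (- t\<^sup>2 / 2) ^ m / fact m) / sqrt (2 * pi) \<ge> exp (- t\<^sup>2 / 2) / sqrt (2 * pi)"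
      using u by (intro divide_right_mono) auto
    then have "(\<Sum>m<n. (- t\<^sup>2 / 2) ^ m / fact m) / sqrt (2 * pi) - std_normal_density t \<ge> 0"
      by (simp add: std_normal_density_def)
    then show "\<exists>y. (?D has_real_derivative y) (at t) \<and> 0 \<le> y"
      using DERIV_diff[OF DERIV_cdivide[OF DERIV_std_normal_taylor] DERIV_std_normal_cdf] by blast
  qed
  then show ?thesis
    by (simp add: std_normal_cdf_0 std_normal_taylor_def)
qed

lemma sqrt_two_pi_bounds: "sqrt (2 * pi) \<ge> 2.50662" "sqrt (2 * pi) \<le> 2.50663"
proof -
  show "sqrt (2 * pi) \<ge> 2.50662"
    using pi_approx by (intro real_le_rsqrt) (simp add: power2_eq_square)
  show "sqrt (2 * pi) \<le> 2.50663"
    using pi_approx by (intro real_le_lsqrt) (simp_all add: power2_eq_square)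
qed

text \<open>The two bounds are the limits of the interval that rounds to 0.6827 at four decimals.
  Six terms bound from below and seven from above.\<close>

lemma std_normal_cdf_1_bounds: "2 * std_normal_cdf 1 - 1 > 0.68265" "2 * std_normal_cdf 1 - 1 < 0.68275"
proof -
  have lo: "std_normal_taylor 6 1 \<ge> 0.85561" and hi: "std_normal_taylor 7 1 \<le> 0.85564"
    by (simp_all add: std_normal_taylor_def eval_nat_numeral)
  have "std_normal_taylor 6 1 / sqrt (2 * pi) \<ge> 0.85561 / 2.50663"
    using sqrt_two_pi_bounds lo by (intro frac_le) auto
  with std_normal_cdf_ge_taylor[of 1 6] show "2 * std_normal_cdf 1 - 1 > 0.68265"
    by simp
  have "std_normal_taylor 7 1 / sqrt (2 * pi) \<le> 0.85564 / 2.50662"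
    using sqrt_two_pi_bounds hi by (intro frac_le) auto
  with std_normal_cdf_le_taylor[of 1 7] show "2 * std_normal_cdf 1 - 1 < 0.68275"
    by simp
qed

section \<open>The standardized inverse Gaussian density\<close>

text \<open>With \<open>s = sqrt (\<mu> / lam)\<close> the standard deviation is \<open>\<mu> s\<close>, and \<open>ig_std s\<close> is the density of
  \<open>Z = (X - \<mu>) / (\<mu> s)\<close>. The signed root \<open>ig_arg s Z\<close> of the exponent satisfies
  \<open>std_normal_density (ig_arg s z) * (ig_arg s)' z = (1 + s z / 2) * ig_std s z\<close>, so tilting the density
  by \<open>1 + s z / 2\<close> turns its integrals into normal ones.\<close>

definition ig_arg :: "real \<Rightarrow> real \<Rightarrow> real" where
  "ig_arg s z = z / sqrt (1 + s * z)"

definition ig_std :: "real \<Rightarrow> real \<Rightarrow> real" where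
  "ig_std s z =
     (if 1 + s * z > 0 then std_normal_density (ig_arg s z) / ((1 + s * z) * sqrt (1 + s * z)) else 0)"

lemma ig_std_nonneg: "ig_std s z \<ge> 0"
  by (simp add: ig_std_def)

lemma borel_measurable_ig_std [measurable]: "ig_std s \<in> borel_measurable borel"
  unfolding ig_std_def[abs_def] ig_arg_def by measurable

lemma DERIV_ig_arg:
  assumes "1 + s * z > 0"
  shows "(ig_arg s has_real_derivative (1 + s * z / 2) / ((1 + s * z) * sqrt (1 + s * z))) (at z)"
proof -
  \<comment> \<open>Written in \<open>r\<close>, with \<open>1 + s * z = r^2\<close>, the quotient
    rule involves only rational expressions.\<close>
  define r where "r = sqrt (1 + s * z)"
  have r: "r > 0" "1 + s * z = r\<^sup>2"
    using assms by (auto simp: r_def)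
  have "((\<lambda>z. sqrt (1 + s * z)) has_real_derivative s / (2 * r)) (at z)"
    using assms by (auto intro!: derivative_eq_intros simp: r_def divide_simps)
  from DERIV_divide[OF DERIV_ident this] r
  have "(ig_arg s has_real_derivative (r - z * (s / (2 * r))) / r\<^sup>2) (at z)"
    by (simp add: ig_arg_def[abs_def] r_def[symmetric] power2_eq_square del: real_sqrt_mult_self)
  also have "r - z * (s / (2 * r)) = (1 + s * z / 2) / r"
    using r by (simp add: field_simps power2_eq_square)
  also have "(1 + s * z / 2) / r / r\<^sup>2 = (1 + s * z / 2) / ((1 + s * z) * r)"
    by (simp add: r(2) mult.commute)
  finally show ?thesis by (simp add: r_def)
qed

lemma isCont_ig_weight:
  "1 + s * z > 0 \<Longrightarrow> isCont (\<lambda>z. (1 + s * z / 2) / ((1 + s * z) * sqrt (1 + s * z))) z"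
  by (intro continuous_intros) auto

lemma isCont_ig_arg: "1 + s * z > 0 \<Longrightarrow> isCont (ig_arg s) z"
  using DERIV_ig_arg DERIV_isCont by blast

lemma isCont_ig_std:
  assumes "1 + s * z > 0"
  shows "isCont (ig_std s) z"
proof -
  have "\<forall>\<^sub>F x in nhds z. 1 + s * x > 0"
    using assms by (intro order_tendstoD(1)[of _ "1 + s * z"] tendsto_intros filterlim_ident)
  then have ev: "\<forall>\<^sub>F x in nhds z. ig_std s x =
      std_normal_density (ig_arg s x) / ((1 + s * x) * sqrt (1 + s * x))"
    by eventually_elim (simp add: ig_std_def)
  have "isCont (\<lambda>x. std_normal_density (ig_arg s x) / ((1 + s * x) * sqrt (1 + s * x))) z"
    by (intro isCont_divide isCont_o2[OF isCont_ig_arg[OF assms] isCont_std_normal_density] continuous_intros)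
      (use assms in auto)
  then show ?thesis
    unfolding isCont_cong[OF ev] .
qed

lemma ig_arg_at_top: "s > 0 \<Longrightarrow> filterlim (ig_arg s) at_top at_top"
  unfolding ig_arg_def[abs_def] by real_asymp

lemma ig_arg_at_right:
  assumes "s > 0"
  shows "filterlim (ig_arg s) at_bot (at_right (- 1 / s))"
proof -
  have ev: "\<forall>\<^sub>F z in at_right (- 1 / s). 0 < sqrt (1 + s * z)"
    unfolding eventually_at_filter using assms
    by (intro always_eventually) (auto simp: field_simps)
  have "((\<lambda>z. sqrt (1 + s * z)) \<longlongrightarrow> sqrt (1 + s * (- 1 / s))) (at_right (- 1 / s))"
    by (intro tendsto_intros)
  then have "((\<lambda>z. sqrt (1 + s * z)) \<longlongrightarrow> 0) (at_right (- 1 / s))"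
    using assms by simp
  then have inf: "filterlim (\<lambda>z. inverse (sqrt (1 + s * z))) at_top (at_right (- 1 / s))"
    using ev by (rule filterlim_inverse_at_top)
  have "filterlim (\<lambda>z. z * inverse (sqrt (1 + s * z))) at_bot (at_right (- 1 / s))"
    by (rule filterlim_tendsto_neg_mult_at_bot[OF _ _ inf, of _ "- 1 / s"])
      (use assms in \<open>auto intro!: tendsto_intros\<close>)
  then show ?thesis
    by (simp add: ig_arg_def[abs_def] divide_inverse)
qed

section \<open>Integrals of the tilted density\<close>

text \<open>\<open>F (ig_arg s z)\<close> is an antiderivative on the half-line, and nonnegativity
  yields integrability together with the value. The lower boundary value enters as a limit so that
  one statement covers a cut inside the support and the singular endpoint \<open>- 1 / s\<close>,
  where \<open>ig_arg s\<close> tends to minus infinity.\<close>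

lemma has_bochner_integral_ig_arg_substitution:
  fixes F f :: "real \<Rightarrow> real"
  assumes s: "s > 0" and a: "a \<ge> - 1 / s"
    and F: "\<And>y. (F has_real_derivative f y) (at y)"
    and cont: "\<And>y. isCont f y" and nonneg: "\<And>y. f y \<ge> 0"
    and A: "((\<lambda>z. F (ig_arg s z)) \<longlongrightarrow> A) (at_right a)"
    and B: "(F \<longlongrightarrow> B) at_top"
  shows "has_bochner_integral lborel
    (\<lambda>z. indicator {a<..} z * (f (ig_arg s z) * ((1 + s * z / 2) / ((1 + s * z) * sqrt (1 + s * z))))) (B - A)"
proof -
  let ?g = "\<lambda>z. f (ig_arg s z) * ((1 + s * z / 2) / ((1 + s * z) * sqrt (1 + s * z)))"
  have pos: "1 + s * z > 0" if "z > a" for z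
    using le_less_trans[OF a that] s by (simp add: field_simps)
  have deriv: "((\<lambda>z. F (ig_arg s z)) has_real_derivative ?g z) (at z)" if "ereal a < ereal z" "ereal z < \<infinity>" for z
    using that by (intro DERIV_chain2[OF F DERIV_ig_arg] pos) auto
  have contg: "isCont ?g z" if "ereal a < ereal z" "ereal z < \<infinity>" for z
    using that by (intro isCont_mult isCont_o2[OF isCont_ig_arg cont] isCont_ig_weight pos) auto
  have nonnegg: "AE z in lborel. ereal a < ereal z \<longrightarrow> ereal z < \<infinity> \<longrightarrow> 0 \<le> ?g z"
  proof (intro AE_I2 impI)
    fix z assume "ereal a < ereal z"
    then have "1 + s * z > 0" by (intro pos) auto
    then show "0 \<le> ?g z"
      by (intro mult_nonneg_nonneg divide_nonneg_nonneg nonneg) auto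
  qed
  have A': "(((\<lambda>z. F (ig_arg s z)) \<circ> real_of_ereal) \<longlongrightarrow> A) (at_right (ereal a))"
    using A by (simp add: ereal_tendsto_simps)
  have B': "(((\<lambda>z. F (ig_arg s z)) \<circ> real_of_ereal) \<longlongrightarrow> B) (at_left \<infinity>)"
    using filterlim_compose[OF B ig_arg_at_top[OF s]] by (simp add: ereal_tendsto_simps)
  note FTC = interval_integral_FTC_nonneg[OF _ deriv contg nonnegg A' B']
  show ?thesis
    using FTC
    by (simp add: has_bochner_integral_iff set_integrable_def interval_lebesgue_integral_def
        set_lebesgue_integral_def)
qed

lemma has_bochner_integral_ig_std_tail:
  assumes s: "s > 0" and a: "1 + s * a > 0"
  shows "has_bochner_integral lborel (\<lambda>z. indicator {a<..} z * ((1 + s * z / 2) * ig_std s z))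
    (1 - std_normal_cdf (ig_arg s a))"
proof -
  have a': "a \<ge> - 1 / s" using a s by (simp add: field_simps)
  have "isCont (\<lambda>z. std_normal_cdf (ig_arg s z)) a"
    by (intro isCont_o2[OF isCont_ig_arg[OF a]] DERIV_isCont[OF DERIV_std_normal_cdf])
  then have "((\<lambda>z. std_normal_cdf (ig_arg s z)) \<longlongrightarrow> std_normal_cdf (ig_arg s a)) (at_right a)"
    by (simp add: isCont_def filterlim_at_split)
  from has_bochner_integral_ig_arg_substitution[OF s a' DERIV_std_normal_cdf
      isCont_std_normal_density normal_density_nonneg this std_normal_cdf_at_top]
  show ?thesis
  proof (rule has_bochner_integral_cong[THEN iffD1, rotated -1])
    fix z
    have "1 + s * z > 0" if "z > a"
      using a mult_strict_left_mono[OF that s] by simp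
    then show "indicator {a<..} z * (std_normal_density (ig_arg s z) *
        ((1 + s * z / 2) / ((1 + s * z) * sqrt (1 + s * z)))) =
        indicator {a<..} z * ((1 + s * z / 2) * ig_std s z)"
      by (cases "z > a") (simp_all add: ig_std_def)
  qed auto
qed

lemma has_bochner_integral_ig_std_weighted:
  assumes s: "s > 0"
  shows "has_bochner_integral lborel (\<lambda>z. (1 + s * z / 2) * ig_std s z) 1"
proof -
  have "((\<lambda>z. std_normal_cdf (ig_arg s z)) \<longlongrightarrow> 0) (at_right (- 1 / s))"
    by (rule filterlim_compose[OF std_normal_cdf_at_bot ig_arg_at_right[OF s]])
  from has_bochner_integral_ig_arg_substitution[OF s order_refl DERIV_std_normal_cdf
      isCont_std_normal_density normal_density_nonneg this std_normal_cdf_at_top]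
  show ?thesis
  proof (rule has_bochner_integral_cong[THEN iffD1, rotated -1])
    fix z
    have "z > - 1 / s \<longleftrightarrow> 1 + s * z > 0"
      using s by (auto simp: field_simps)
    then show "indicator {- 1 / s<..} z * (std_normal_density (ig_arg s z) *
        ((1 + s * z / 2) / ((1 + s * z) * sqrt (1 + s * z)))) =
        (1 + s * z / 2) * ig_std s z"
      by (simp add: indicator_def ig_std_def)
  qed auto
qed

text \<open>In the variable \<open>ig_arg s z\<close> this is the second moment of the standard
  normal law, whose antiderivative \<open>?F\<close> comes from integration by parts. It provides
  the dominating function for \<open>z^2 * ig_std s z\<close>.\<close>

lemma has_bochner_integral_ig_std_weighted_square:
  assumes s: "s > 0"
  shows "has_bochner_integral lborel (\<lambda>z. (ig_arg s z)\<^sup>2 * ((1 + s * z / 2) * ig_std s z)) 1"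
proof -
  let ?F = "\<lambda>y. std_normal_cdf y - y * std_normal_density y"
  have deriv: "(?F has_real_derivative y\<^sup>2 * std_normal_density y) (at y)" for y
    by (auto intro!: derivative_eq_intros DERIV_std_normal_cdf DERIV_std_normal_density
        simp: power2_eq_square algebra_simps)
  have "((\<lambda>y. y * std_normal_density y) \<longlongrightarrow> 0) at_top"
    unfolding std_normal_density_def by real_asymp
  then have B: "(?F \<longlongrightarrow> 1) at_top"
    using tendsto_diff[OF std_normal_cdf_at_top] by fastforce
  have "((\<lambda>y. y * std_normal_density y) \<longlongrightarrow> 0) at_bot"
    unfolding std_normal_density_def by real_asymp
  then have "(?F \<longlongrightarrow> 0) at_bot"
    using tendsto_diff[OF std_normal_cdf_at_bot] by fastforce
  then have A: "((\<lambda>z. ?F (ig_arg s z)) \<longlongrightarrow> 0) (at_right (- 1 / s))"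
    by (rule filterlim_compose[OF _ ig_arg_at_right[OF s]])
  have "isCont (\<lambda>y. y\<^sup>2 * std_normal_density y) y" for y
    by (intro continuous_intros)
  from has_bochner_integral_ig_arg_substitution[OF s order_refl deriv this _ A B]
  have "has_bochner_integral lborel (\<lambda>z. indicator {- 1 / s<..} z *
      ((ig_arg s z)\<^sup>2 * std_normal_density (ig_arg s z) *
       ((1 + s * z / 2) / ((1 + s * z) * sqrt (1 + s * z))))) 1"
    by simp
  then show ?thesis
  proof (rule has_bochner_integral_cong[THEN iffD1, rotated -1])
    fix z
    have "z > - 1 / s \<longleftrightarrow> 1 + s * z > 0"
      using s by (auto simp: field_simps)
    then show "indicator {- 1 / s<..} z * ((ig_arg s z)\<^sup>2 * std_normal_density (ig_arg s z) *
        ((1 + s * z / 2) / ((1 + s * z) * sqrt (1 + s * z)))) =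
        (ig_arg s z)\<^sup>2 * ((1 + s * z / 2) * ig_std s z)"
      by (simp add: indicator_def ig_std_def)
  qed auto
qed

section \<open>Integrability and the first two moments\<close>

text \<open>On the support \<open>1 + s * z > 0\<close>, so twice the tilt,
  \<open>2 + s * z\<close>, exceeds both 1 and \<open>1 + s * z\<close>. Since
  \<open>z^2 = (ig_arg s z)^2 * (1 + s * z)\<close> there, the doubled tilted integrands dominate
  the plain ones.\<close>

lemma integrable_ig_std:
  assumes s: "s > 0"
  shows "integrable lborel (ig_std s)"
    and "integrable lborel (\<lambda>z. z * ig_std s z)"
    and "integrable lborel (\<lambda>z. z\<^sup>2 * ig_std s z)"
proof -
  note int0 = has_bochner_integral_ig_std_weighted[OF s, unfolded has_bochner_integral_iff, THEN conjunct1]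
  note int2 = has_bochner_integral_ig_std_weighted_square[OF s, unfolded has_bochner_integral_iff, THEN conjunct1]
  show i0: "integrable lborel (ig_std s)"
  proof (rule Bochner_Integration.integrable_bound[OF integrable_mult_right[OF int0, of 2]])
    show "AE z in lborel. norm (ig_std s z) \<le> norm (2 * ((1 + s * z / 2) * ig_std s z))"
    proof (rule AE_I2)
      fix z
      have "1 * ig_std s z \<le> (2 * (1 + s * z / 2)) * ig_std s z"
      proof (cases "1 + s * z > 0")
        case True
        then show ?thesis by (intro mult_right_mono ig_std_nonneg) auto
      qed (simp add: ig_std_def)
      then show "norm (ig_std s z) \<le> norm (2 * ((1 + s * z / 2) * ig_std s z))"
        using ig_std_nonneg[of s z] by (simp add: algebra_simps)
    qed
  qed simp
  show "integrable lborel (\<lambda>z. z\<^sup>2 * ig_std s z)"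
  proof (rule Bochner_Integration.integrable_bound[OF integrable_mult_right[OF int2, of 2]])
    show "AE z in lborel. norm (z\<^sup>2 * ig_std s z) \<le>
        norm (2 * ((ig_arg s z)\<^sup>2 * ((1 + s * z / 2) * ig_std s z)))"
    proof (rule AE_I2)
      fix z
      have "z\<^sup>2 * ig_std s z \<le> 2 * ((ig_arg s z)\<^sup>2 * ((1 + s * z / 2) * ig_std s z))"
      proof (cases "1 + s * z > 0")
        case True
        have "z\<^sup>2 = (ig_arg s z)\<^sup>2 * (1 + s * z)"
          using True by (simp add: ig_arg_def power_divide)
        also have "\<dots> \<le> (ig_arg s z)\<^sup>2 * (2 * (1 + s * z / 2))"
          by (intro mult_left_mono) auto
        finally have "z\<^sup>2 * ig_std s z \<le> (ig_arg s z)\<^sup>2 * (2 * (1 + s * z / 2)) * ig_std s z"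
          by (intro mult_right_mono ig_std_nonneg)
        then show ?thesis by (simp add: algebra_simps)
      qed (simp add: ig_std_def)
      moreover have "z\<^sup>2 * ig_std s z \<ge> 0"
        by (simp add: ig_std_nonneg)
      ultimately show "norm (z\<^sup>2 * ig_std s z) \<le>
          norm (2 * ((ig_arg s z)\<^sup>2 * ((1 + s * z / 2) * ig_std s z)))"
        by simp
    qed
  qed simp
  have "integrable lborel (\<lambda>z. 2 / s * ((1 + s * z / 2) * ig_std s z - ig_std s z))"
    by (intro integrable_mult_right Bochner_Integration.integrable_diff int0 i0)
  also have "(\<lambda>z. 2 / s * ((1 + s * z / 2) * ig_std s z - ig_std s z)) = (\<lambda>z. z * ig_std s z)"
    using s by (auto simp: field_simps)
  finally show "integrable lborel (\<lambda>z. z * ig_std s z)" .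
qed

text \<open>The tilted and the plain density both have mass 1, and their difference is
  \<open>s / 2 * z * ig_std s z\<close>.\<close>

lemma integral_ig_std_first_moment:
  assumes s: "s > 0" and one: "(\<integral>z. ig_std s z \<partial>lborel) = 1"
  shows "(\<integral>z. z * ig_std s z \<partial>lborel) = 0"
proof -
  have "1 = (\<integral>z. ig_std s z + s / 2 * (z * ig_std s z) \<partial>lborel)"
    using has_bochner_integral_ig_std_weighted[OF s]
    by (simp add: has_bochner_integral_iff algebra_simps)
  also have "\<dots> = 1 + s / 2 * (\<integral>z. z * ig_std s z \<partial>lborel)"
    using integrable_ig_std[OF s] one by simp
  finally show ?thesis using s by simp
qed

text \<open>Stein's identity: integrates the derivative of \<open>sqrt (1 + s z) * std_normal_density (ig_arg s z)\<close>.\<close>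

lemma integral_ig_std_second_moment:
  assumes s: "s > 0" and one: "(\<integral>z. ig_std s z \<partial>lborel) = 1"
  shows "(\<integral>z. z\<^sup>2 * ig_std s z \<partial>lborel) = 1"
proof -
  let ?F = "\<lambda>z. sqrt (1 + s * z) * std_normal_density (ig_arg s z)"
  let ?f = "\<lambda>z. ig_std s z * (s / 2 + s\<^sup>2 / 2 * z - z - s / 2 * z\<^sup>2)"
  have pos: "1 + s * z > 0 \<longleftrightarrow> - 1 / s < z" for z
    using s by (auto simp: field_simps)
  have f_eq: "?f z = s / 2 * ig_std s z + s\<^sup>2 / 2 * (z * ig_std s z) - z * ig_std s z
      - s / 2 * (z\<^sup>2 * ig_std s z)" for z
    by (simp add: algebra_simps)
  have int: "integrable lborel ?f"
    unfolding f_eq using integrable_ig_std[OF s] by simp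
  have deriv: "(?F has_vector_derivative ?f z) (at z)"
    if "ereal (- 1 / s) < ereal z" "ereal z < \<infinity>" for z
  proof -
    define r where "r = sqrt (1 + s * z)"
    have z: "1 + s * z > 0" using that pos by simp
    have r: "r > 0" "1 + s * z = r\<^sup>2"
      using z by (auto simp: r_def)
    have "((\<lambda>z. sqrt (1 + s * z)) has_real_derivative s / (2 * r)) (at z)"
      using z by (auto intro!: derivative_eq_intros simp: r_def divide_simps)
    from DERIV_mult[OF this DERIV_chain2[OF DERIV_std_normal_density DERIV_ig_arg[OF z]]]
    have "(?F has_real_derivative
        s / (2 * r) * std_normal_density (ig_arg s z) +
        (- ig_arg s z * std_normal_density (ig_arg s z) * ((1 + s * z / 2) / (r\<^sup>2 * r))) * r) (at z)"
      by (simp add: r_def[symmetric] r(2)[symmetric])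
    also have "s / (2 * r) * std_normal_density (ig_arg s z) +
        (- ig_arg s z * std_normal_density (ig_arg s z) * ((1 + s * z / 2) / (r\<^sup>2 * r))) * r =
        std_normal_density (ig_arg s z) / (r\<^sup>2 * r) * (s / 2 * r\<^sup>2 - z * (1 + s * z / 2))"
    proof -
      have "s / (2 * r) * p + (- (z / r) * p * ((1 + s * z / 2) / (r\<^sup>2 * r))) * r =
          p / (r\<^sup>2 * r) * (s / 2 * r\<^sup>2 - z * (1 + s * z / 2))" for p
        using r(1) by (simp add: field_simps power2_eq_square)
      moreover have "ig_arg s z = z / r" by (simp add: ig_arg_def r_def)
      ultimately show ?thesis by metis
    qed
    also have "\<dots> = ?f z"
      unfolding r(2)[symmetric] using z
      by (simp add: ig_std_def r_def algebra_simps power2_eq_square add_divide_distrib)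
    finally show ?thesis
      by (simp add: has_real_derivative_iff_has_vector_derivative)
  qed
  have cont: "isCont ?f z" if "ereal (- 1 / s) < ereal z" "ereal z < \<infinity>" for z
    using that pos by (intro continuous_intros isCont_ig_std) auto
  \<comment> \<open>Both boundary terms vanish: at \<open>- 1 / s\<close> each factor of
    \<open>?F\<close> tends to 0, and at infinity the density, of order
    \<open>exp (- z / (2 * s))\<close>, beats the square root.\<close>
  have "((\<lambda>z. sqrt (1 + s * z)) \<longlongrightarrow> sqrt (1 + s * (- 1 / s))) (at_right (- 1 / s))"
    by (intro tendsto_intros)
  moreover have "(std_normal_density \<longlongrightarrow> 0) at_bot"
    unfolding std_normal_density_def by real_asymp
  then have "((\<lambda>z. std_normal_density (ig_arg s z)) \<longlongrightarrow> 0) (at_right (- 1 / s))"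
    by (rule filterlim_compose[OF _ ig_arg_at_right[OF s]])
  ultimately have "(?F \<longlongrightarrow> 0) (at_right (- 1 / s))"
    using tendsto_mult by fastforce
  then have A: "((?F \<circ> real_of_ereal) \<longlongrightarrow> 0) (at_right (ereal (- 1 / s)))"
    by (simp add: ereal_tendsto_simps)
  have "(?F \<longlongrightarrow> 0) at_top"
    unfolding std_normal_density_def ig_arg_def using s by real_asymp
  then have B: "((?F \<circ> real_of_ereal) \<longlongrightarrow> 0) (at_left \<infinity>)"
    by (simp add: ereal_tendsto_simps)
  have "set_integrable lborel (einterval (ereal (- 1 / s)) \<infinity>) ?f"
    unfolding set_integrable_def using int by (intro integrable_mult_indicator) auto
  from interval_integral_FTC_integrable[OF _ deriv cont this A B]
  have "(\<integral>z. indicator {- 1 / s<..} z *\<^sub>R ?f z \<partial>lborel) = 0"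
    by (simp add: interval_lebesgue_integral_def set_lebesgue_integral_def)
  also have "(\<integral>z. indicator {- 1 / s<..} z *\<^sub>R ?f z \<partial>lborel) = (\<integral>z. ?f z \<partial>lborel)"
    by (intro Bochner_Integration.integral_cong) (auto simp: indicator_def ig_std_def pos)
  \<comment> \<open>The terms linear in \<open>z\<close> drop out because the first moment is
    0.\<close>
  also have "\<dots> = s / 2 - s / 2 * (\<integral>z. z\<^sup>2 * ig_std s z \<partial>lborel)"
    unfolding f_eq using integrable_ig_std[OF s] integral_ig_std_first_moment[OF s one] one by simp
  finally show ?thesis using s by simp
qed

section \<open>Mass within one standard deviation\<close>

definition ig_prob :: "real \<Rightarrow> real" where
  "ig_prob s = (\<integral>z. indicator {-1..1} z * ig_std s z \<partial>lborel)"

lemma std_normal_prob: "(\<integral>z. indicator {-1..1} z * std_normal_density z \<partial>lborel) = 2 * std_normal_cdf 1 - 1"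
proof -
  have "has_bochner_integral lborel (\<lambda>z. std_normal_density z * indicator {-1..1} z)
      (std_normal_cdf 1 - std_normal_cdf (-1))"
    by (rule has_bochner_integral_FTC_Icc_real) (auto intro: DERIV_std_normal_cdf isCont_std_normal_density)
  then show ?thesis
    by (simp add: has_bochner_integral_iff std_normal_cdf_uminus mult.commute)
qed

section \<open>Small \<open>s\<close>: pointwise comparison with the normal density\<close>

text \<open>All terms of the logarithm series are nonpositive here, so truncation gives an upper
  bound; in the proof the derivative of the difference is \<open>t^2 / (1 - t)\<close>.\<close>

lemma ln_one_minus_le_quadratic:
  fixes u :: real
  assumes "0 \<le> u" "u < 1"
  shows "ln (1 - u) \<le> - u - u\<^sup>2 / 2"
proof -
  let ?D = "\<lambda>u. - u - u\<^sup>2 / 2 - ln (1 - u)"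
  have "?D 0 \<le> ?D u"
  proof (rule DERIV_nonneg_imp_nondecreasing[OF assms(1)])
    fix t assume t: "0 \<le> t" "t \<le> u"
    have "(?D has_real_derivative - 1 - t + 1 / (1 - t)) (at t)"
      using t assms by (auto intro!: derivative_eq_intros simp: divide_simps) (simp add: algebra_simps)
    moreover have "- 1 - t + 1 / (1 - t) = t\<^sup>2 / (1 - t)"
      using t assms by (simp add: field_simps power2_eq_square)
    moreover have "t\<^sup>2 / (1 - t) \<ge> 0"
      using t assms by simp
    ultimately show "\<exists>y. (?D has_real_derivative y) (at t) \<and> 0 \<le> y"
      by metis
  qed
  then show ?thesis by simp
qed

lemma ig_std_eq_exp:
  assumes "1 + s * z > 0"
  shows "ig_std s z = exp (- z\<^sup>2 / (2 * (1 + s * z)) - 3 / 2 * ln (1 + s * z)) / sqrt (2 * pi)"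
proof -
  have "exp (3 / 2 * ln (1 + s * z)) = exp (ln (1 + s * z) + ln (1 + s * z) / 2)"
    by (rule arg_cong[where f = exp]) (simp add: field_simps)
  also have "\<dots> = (1 + s * z) * sqrt (1 + s * z)"
    using assms by (simp add: exp_add ln_sqrt[symmetric])
  finally have e: "exp (3 / 2 * ln (1 + s * z)) = (1 + s * z) * sqrt (1 + s * z)" .
  have a: "- (ig_arg s z)\<^sup>2 / 2 = - z\<^sup>2 / (2 * (1 + s * z))"
    using assms by (simp add: ig_arg_def power_divide)
  show ?thesis
    using assms unfolding ig_std_def std_normal_density_def a exp_diff e by simp
qed

text \<open>AM-GM for \<open>exp a\<close> and \<open>exp b\<close>, from the square of the
  difference of \<open>exp (a / 2)\<close> and \<open>exp (b / 2)\<close>.\<close>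

lemma exp_midpoint_le: "2 * exp ((a + b) / 2) \<le> exp a + exp (b :: real)"
proof -
  have "exp x = (exp (x / 2))\<^sup>2" for x :: real
    by (simp add: power2_eq_square exp_add[symmetric])
  from this[of a] this[of b] show ?thesis
    using sum_squares_bound[of "exp (a / 2)" "exp (b / 2)"]
    by (simp add: add_divide_distrib exp_add)
qed

text \<open>Averaging the two exponents cancels their odd parts, and only
  \<open>u = (s * z)^2\<close> and \<open>z^2\<close> remain. The claim becomes
  \<open>z^2 * (u / (1 - u)) < - 3 / 2 * ln (1 - u)\<close>, where \<open>z^2 \<le> 1\<close> allows
  dropping the first factor. At \<open>z = 0\<close> the two sides coincide.\<close>

lemma std_normal_density_less_symmetrized_ig_std:
  assumes s: "0 < s" "s \<le> 2 / 3" and z: "\<bar>z\<bar> \<le> 1" "z \<noteq> 0"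
  shows "std_normal_density z < (ig_std s z + ig_std s (- z)) / 2"
proof -
  define u where "u = (s * z)\<^sup>2"
  have "\<bar>s * z\<bar> \<le> 2 / 3 * 1"
    unfolding abs_mult using s z by (intro mult_mono) auto
  then have sz: "\<bar>s * z\<bar> \<le> 2 / 3" by simp
  then have pos: "1 + s * z > 0" "1 - s * z > 0" by linarith+
  have "\<bar>s * z\<bar>\<^sup>2 \<le> (2 / 3)\<^sup>2"
    using sz by (intro power_mono) auto
  then have "u \<le> 4 / 9"
    by (simp add: u_def power2_eq_square)
  moreover have "0 < u"
    using s z by (simp add: u_def)
  ultimately have u: "0 < u" "u \<le> 4 / 9" by auto
  have prod: "(1 + s * z) * (1 - s * z) = 1 - u"
    by (simp add: u_def power2_eq_square algebra_simps)
  let ?a = "- z\<^sup>2 / (2 * (1 + s * z)) - 3 / 2 * ln (1 + s * z)"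
  let ?b = "- z\<^sup>2 / (2 * (1 - s * z)) - 3 / 2 * ln (1 - s * z)"
  have "- z\<^sup>2 / (2 * (1 + s * z)) + - z\<^sup>2 / (2 * (1 - s * z)) = - z\<^sup>2 / ((1 + s * z) * (1 - s * z))"
    using pos by (simp add: divide_simps) (simp add: algebra_simps)
  moreover have "ln (1 + s * z) + ln (1 - s * z) = ln (1 - u)"
    using pos ln_mult[of "1 + s * z" "1 - s * z"] prod by simp
  ultimately have mid: "(?a + ?b) / 2 = - (z\<^sup>2 / (1 - u)) / 2 - 3 / 4 * ln (1 - u)"
    unfolding prod by (simp add: field_simps)
  \<comment> \<open>Equivalent to \<open>u + u^2 < 2 / 3\<close>; at \<open>u = 4 / 9\<close> the
    left side is 52/81. This inequality sets the threshold 2/3 for \<open>s\<close>.\<close>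
  have "1 < 3 / 2 * (1 + u / 2) * (1 - u)"
  proof -
    have "u * u \<le> 4 / 9 * (4 / 9)"
      using u by (intro mult_mono) auto
    moreover have "3 / 2 * (1 + u / 2) * (1 - u) = 3 / 2 - 3 / 4 * u - 3 / 4 * (u * u)"
      by (simp add: field_simps)
    ultimately show ?thesis using u by linarith
  qed
  then have "1 / (1 - u) < 3 / 2 * (1 + u / 2)"
    using u by (simp add: field_simps)
  then have "u * (1 / (1 - u)) < u * (3 / 2 * (1 + u / 2))"
    using u by (intro mult_strict_left_mono) auto
  also have "\<dots> = 3 / 2 * (u + u\<^sup>2 / 2)"
    by (simp add: algebra_simps power2_eq_square)
  also have "\<dots> \<le> - (3 / 2 * ln (1 - u))"
    using ln_one_minus_le_quadratic[of u] u by simp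
  finally have less: "u / (1 - u) < - (3 / 2 * ln (1 - u))" by simp
  have "z\<^sup>2 * (u / (1 - u)) \<le> 1 * (u / (1 - u))"
    using u z by (intro mult_right_mono) (auto simp: abs_square_le_1)
  then have "z\<^sup>2 * (u / (1 - u)) < - (3 / 2 * ln (1 - u))"
    using less by simp
  also have "z\<^sup>2 * (u / (1 - u)) = z\<^sup>2 / (1 - u) - z\<^sup>2"
    using u by (simp add: field_simps)
  finally have less': "z\<^sup>2 / (1 - u) - z\<^sup>2 < - (3 / 2 * ln (1 - u))" .
  have "- q / 2 < - p / 2 - 3 / 4 * l" if "p - q < - (3 / 2 * l)" for p q l :: real
    using that by simp
  from this[OF less'] have "- z\<^sup>2 / 2 < (?a + ?b) / 2"
    unfolding mid .
  then have "2 * exp (- z\<^sup>2 / 2) < 2 * exp ((?a + ?b) / 2)"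
    by simp
  also have "\<dots> \<le> exp ?a + exp ?b"
    by (rule exp_midpoint_le)
  finally have "2 * exp (- z\<^sup>2 / 2) / sqrt (2 * pi) < (exp ?a + exp ?b) / sqrt (2 * pi)"
    by (intro divide_strict_right_mono) auto
  then show ?thesis
    using pos ig_std_eq_exp[of s z] ig_std_eq_exp[of s "- z"]
    by (simp add: std_normal_density_def add_divide_distrib)
qed

lemma integrable_indicator_ig_std:
  "s > 0 \<Longrightarrow> A \<in> sets borel \<Longrightarrow> integrable lborel (\<lambda>z. indicator A z * ig_std s z)"
  using integrable_mult_indicator[of A lborel "ig_std s"] integrable_ig_std(1) by simp

lemma ig_prob_gt_small:
  assumes s: "0 < s" "s \<le> 2 / 3"
  shows "ig_prob s > 2 * std_normal_cdf 1 - 1"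
proof -
  let ?I = "indicator {-1..1} :: real \<Rightarrow> real"
  have int: "integrable lborel (\<lambda>z. ?I z * ig_std s z)"
    by (rule integrable_indicator_ig_std) (use s in auto)
  \<comment> \<open>Reflection, in the form \<open>0 + (-1) * z\<close> expected by the affine
    substitution rule; the interval is symmetric.\<close>
  have flip: "(\<lambda>z. ?I (0 + (-1) * z) * ig_std s (0 + (-1) * z)) = (\<lambda>z. ?I z * ig_std s (- z))"
    by (auto simp: indicator_def)
  have "has_bochner_integral lborel (\<lambda>z. ?I z * ig_std s z) (ig_prob s)"
    using int by (simp add: has_bochner_integral_iff ig_prob_def)
  moreover from this have "has_bochner_integral lborel (\<lambda>z. ?I z * ig_std s (- z)) (ig_prob s)"
    using lborel_has_bochner_integral_real_affine_iff[of "-1" "\<lambda>z. ?I z * ig_std s z" "ig_prob s" 0]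
    unfolding flip by simp
  ultimately have "has_bochner_integral lborel (\<lambda>z. (?I z * ig_std s z + ?I z * ig_std s (- z)) / 2)
      ((ig_prob s + ig_prob s) / 2)"
    by (intro has_bochner_integral_divide_zero has_bochner_integral_add)
  then have sym: "has_bochner_integral lborel (\<lambda>z. (?I z * ig_std s z + ?I z * ig_std s (- z)) / 2) (ig_prob s)"
    by simp
  let ?g = "\<lambda>z. (?I z * ig_std s z + ?I z * ig_std s (- z)) / 2 - ?I z * std_normal_density z"
  have "has_bochner_integral lborel (\<lambda>z. ?I z * std_normal_density z) (2 * std_normal_cdf 1 - 1)"
    using integrable_mult_indicator[of "{-1..1}" lborel std_normal_density]
    by (simp add: has_bochner_integral_iff std_normal_prob)
  then have g: "has_bochner_integral lborel ?g (ig_prob s - (2 * std_normal_cdf 1 - 1))"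
    by (intro has_bochner_integral_diff sym)
  have g_pos: "?g z > 0" if "\<bar>z\<bar> \<le> 1" "z \<noteq> 0" for z
    using std_normal_density_less_symmetrized_ig_std[OF s that] that
    by (simp add: indicator_def abs_le_iff)
  have g_nonneg: "AE z in lborel. ?g z \<ge> 0"
    using AE_lborel_singleton[of 0]
  proof eventually_elim
    case (elim z)
    then show ?case
      using g_pos[of z] by (cases "\<bar>z\<bar> \<le> 1") (auto simp: indicator_def)
  qed
  \<comment> \<open>Strictness survives integration: a zero integral of the nonnegative
    \<open>?g\<close> would make it vanish almost everywhere, yet it is positive on an interval of
    length 1.\<close>
  have "ig_prob s - (2 * std_normal_cdf 1 - 1) \<noteq> 0"
  proof
    assume "ig_prob s - (2 * std_normal_cdf 1 - 1) = 0"
    then have "AE z in lborel. ?g z = 0"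
      using g integral_nonneg_eq_0_iff_AE[of lborel ?g] g_nonneg
      by (auto simp: has_bochner_integral_iff)
    then have "AE z in lborel. z \<notin> {0<..1::real}"
    proof eventually_elim
      case (elim z)
      then show ?case using g_pos[of z] by auto
    qed
    then have "{0<..1::real} \<in> null_sets lborel"
      by (subst AE_iff_null_sets) auto
    then show False by (auto dest: null_setsD1)
  qed
  moreover have "ig_prob s - (2 * std_normal_cdf 1 - 1) \<ge> 0"
    using integral_nonneg_AE[OF g_nonneg] g by (simp add: has_bochner_integral_iff)
  ultimately show ?thesis by linarith
qed

section \<open>Large \<open>s\<close>: tail bounds\<close>

text \<open>For \<open>z > 1\<close> the tilt is at least \<open>1 + s / 2\<close>, and the tilted
  tail is exactly a normal tail.\<close>

lemma integral_ig_std_upper_tail_le: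
  assumes s: "s > 0"
  shows "(\<integral>z. indicator {1<..} z * ig_std s z \<partial>lborel) \<le> (1 - std_normal_cdf (ig_arg s 1)) / (1 + s / 2)"
proof -
  note tail = has_bochner_integral_ig_std_tail[OF s, of 1]
  have "(1 + s / 2) * (\<integral>z. indicator {1<..} z * ig_std s z \<partial>lborel)
      = (\<integral>z. (1 + s / 2) * (indicator {1<..} z * ig_std s z) \<partial>lborel)"
    by simp
  also have "\<dots> \<le> (\<integral>z. indicator {1<..} z * ((1 + s * z / 2) * ig_std s z) \<partial>lborel)"
  proof (intro integral_mono)
    show "integrable lborel (\<lambda>z. (1 + s / 2) * (indicator {1<..} z * ig_std s z))"
      by (intro integrable_mult_right integrable_indicator_ig_std s) auto
    show "integrable lborel (\<lambda>z. indicator {1<..} z * ((1 + s * z / 2) * ig_std s z))"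
      using tail s by (simp add: has_bochner_integral_iff)
    fix z
    show "(1 + s / 2) * (indicator {1<..} z * ig_std s z) \<le> indicator {1<..} z * ((1 + s * z / 2) * ig_std s z)"
      using s by (auto simp: indicator_def intro!: mult_right_mono ig_std_nonneg)
  qed
  also have "\<dots> = 1 - std_normal_cdf (ig_arg s 1)"
    using tail s by (simp add: has_bochner_integral_iff)
  finally show ?thesis
    using s by (simp add: field_simps)
qed

text \<open>On the support \<open>1 + s * z / 2 > 1 / 2\<close>, hence the factor 2. The assumption
  \<open>s < 1\<close> puts the cut -1 inside the support.\<close>

lemma integral_ig_std_lower_tail_le:
  assumes s: "0 < s" "s < 1"
  shows "(\<integral>z. indicator {..-1} z * ig_std s z \<partial>lborel) \<le> 2 * std_normal_cdf (ig_arg s (-1))"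
proof -
  let ?w = "\<lambda>z. (1 + s * z / 2) * ig_std s z"
  note tail = has_bochner_integral_ig_std_tail[OF s(1), of "-1"]
  \<comment> \<open>The tilted mass below -1 is the total mass 1 minus the upper tail.\<close>
  have below: "has_bochner_integral lborel (\<lambda>z. ?w z - indicator {-1<..} z * ?w z)
      (1 - (1 - std_normal_cdf (ig_arg s (-1))))"
    using s by (intro has_bochner_integral_diff has_bochner_integral_ig_std_weighted tail) auto
  have "(\<integral>z. indicator {..-1} z * ig_std s z \<partial>lborel) \<le>
      (\<integral>z. 2 * (?w z - indicator {-1<..} z * ?w z) \<partial>lborel)"
  proof (intro integral_mono)
    show "integrable lborel (\<lambda>z. indicator {..-1} z * ig_std s z)"
      by (intro integrable_indicator_ig_std s) auto
    show "integrable lborel (\<lambda>z. 2 * (?w z - indicator {-1<..} z * ?w z))"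
      using below by (intro integrable_mult_right) (simp add: has_bochner_integral_iff)
    fix z
    show "indicator {..-1} z * ig_std s z \<le> 2 * (?w z - indicator {-1<..} z * ?w z)"
    proof (cases "z \<le> -1 \<and> 1 + s * z > 0")
      case True
      then have "1 * ig_std s z \<le> (2 + s * z) * ig_std s z"
        by (intro mult_right_mono ig_std_nonneg) auto
      with True show ?thesis by (simp add: algebra_simps)
    qed (auto simp: ig_std_def indicator_def)
  qed
  also have "\<dots> = 2 * (\<integral>z. ?w z - indicator {-1<..} z * ?w z \<partial>lborel)"
    by (rule integral_mult_right_zero)
  also have "\<dots> = 2 * std_normal_cdf (ig_arg s (-1))"
    using below by (simp add: has_bochner_integral_iff)
  finally show ?thesis .
qed

text \<open>The support begins at \<open>- 1 / s\<close>, which is now no smaller than -1.\<close>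

lemma integral_ig_std_lower_tail_eq_0:
  assumes s: "1 \<le> s"
  shows "(\<integral>z. indicator {..-1} z * ig_std s z \<partial>lborel) = 0"
proof -
  have "indicator {..-1} z * ig_std s z = 0" for z
  proof (cases "z \<le> -1")
    case True
    then have "s * z \<le> 1 * (-1)"
      using s mult_mono[of 1 s 1 "- z"] by simp
    then show ?thesis by (simp add: ig_std_def)
  qed auto
  then have "(\<integral>z. indicator {..-1} z * ig_std s z \<partial>lborel) = (\<integral>z. 0 \<partial>(lborel :: real measure))"
    by (intro Bochner_Integration.integral_cong refl)
  then show ?thesis by simp
qed

lemma ig_prob_eq_tails:
  assumes s: "0 < s" and one: "(\<integral>z. ig_std s z \<partial>lborel) = 1"
  shows "ig_prob s = 1 - (\<integral>z. indicator {..-1} z * ig_std s z \<partial>lborel)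
    - (\<integral>z. indicator {1<..} z * ig_std s z \<partial>lborel)"
proof -
  note int = integrable_indicator_ig_std[OF s]
  have "(\<integral>z. ig_std s z \<partial>lborel) = (\<integral>z. indicator {..-1} z * ig_std s z + indicator {-1<..1} z * ig_std s z
      + indicator {1<..} z * ig_std s z \<partial>lborel)"
    by (intro Bochner_Integration.integral_cong) (auto simp: indicator_def)
  also have "\<dots> = (\<integral>z. indicator {..-1} z * ig_std s z \<partial>lborel) + (\<integral>z. indicator {-1<..1} z * ig_std s z \<partial>lborel)
      + (\<integral>z. indicator {1<..} z * ig_std s z \<partial>lborel)"
    by (simp add: int)
  \<comment> \<open>The point -1, counted with the lower tail, is a null set.\<close>
  also have "(\<integral>z. indicator {-1<..1} z * ig_std s z \<partial>lborel) = ig_prob s"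
    unfolding ig_prob_def using AE_lborel_singleton[of "-1"]
    by (intro integral_cong_AE) (auto simp: indicator_def)
  finally show ?thesis using one by simp
qed

text \<open>The arguments are rational values just below \<open>1 / sqrt 3\<close>,
  \<open>1 / sqrt 2\<close> and \<open>sqrt 3\<close>, the extreme values of
  \<open>1 / sqrt (1 + s)\<close> at \<open>s = 2\<close> and \<open>s = 1\<close> and of
  \<open>1 / sqrt (1 - s)\<close> at \<open>s = 2 / 3\<close>.\<close>

lemma std_normal_cdf_lower_bounds:
  "std_normal_cdf 0.57 \<ge> 0.7" "std_normal_cdf 0.7 \<ge> 0.75" "std_normal_cdf 1.7 \<ge> 0.95"
proof -
  have *: "std_normal_cdf x \<ge> 1 / 2 + c / 2.50663"
    if "std_normal_taylor n x \<ge> c" "x \<ge> 0" "c \<ge> 0" "even n" for x c n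
  proof -
    have "c / 2.50663 \<le> std_normal_taylor n x / sqrt (2 * pi)"
      using that sqrt_two_pi_bounds by (intro frac_le) auto
    then show ?thesis
      using std_normal_cdf_ge_taylor[of x n] that by simp
  qed
  have "std_normal_taylor 2 0.57 \<ge> 0.53" "std_normal_taylor 2 0.7 \<ge> 0.63" "std_normal_taylor 6 1.7 \<ge> 1.13"
    by (simp_all add: std_normal_taylor_def eval_nat_numeral)
  from this[THEN *]
  show "std_normal_cdf 0.57 \<ge> 0.7" "std_normal_cdf 0.7 \<ge> 0.75" "std_normal_cdf 1.7 \<ge> 0.95"
    by simp_all
qed

text \<open>Outside mass below 0.31 suffices, since the normal mass outside exceeds
  \<open>1 - 0.68275 = 0.31725\<close>. The lower tail disappears at \<open>s = 1\<close>; from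
  \<open>s = 2\<close> on, the trivial bound 1/2 for the normal distribution function is
  enough.\<close>

lemma ig_prob_gt_large:
  assumes s: "2 / 3 \<le> s" and one: "(\<integral>z. ig_std s z \<partial>lborel) = 1"
  shows "ig_prob s > 2 * std_normal_cdf 1 - 1"
proof -
  let ?L = "\<integral>z. indicator {..-1} z * ig_std s z \<partial>lborel"
  let ?U = "\<integral>z. indicator {1<..} z * ig_std s z \<partial>lborel"
  have upper: "?U \<le> (1 - p) / (1 + c / 2)"
    if "c \<le> s" "0 \<le> c" "p \<le> std_normal_cdf x" "x \<le> 1 / sqrt (1 + s)" "p \<le> 1" for c p x
  proof -
    have "p \<le> std_normal_cdf (ig_arg s 1)"
      using std_normal_cdf_mono[of x "1 / sqrt (1 + s)"] that by (simp add: ig_arg_def)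
    then have "(1 - std_normal_cdf (ig_arg s 1)) / (1 + s / 2) \<le> (1 - p) / (1 + c / 2)"
      using that s by (intro frac_le) auto
    then show ?thesis
      using integral_ig_std_upper_tail_le[of s] s by linarith
  qed
  have inv: "x \<le> 1 / sqrt (1 + s)" if "x > 0" "1 + s \<le> 1 / x\<^sup>2" for x
  proof -
    have "sqrt (1 + s) \<le> 1 / x"
      using that by (intro real_le_lsqrt) (use s in \<open>auto simp: power_divide\<close>)
    then show ?thesis
      using that s by (simp add: field_simps)
  qed
  consider "s < 1" | "1 \<le> s" "s \<le> 2" | "2 \<le> s" by linarith
  then have "?L + ?U < 0.31"
  proof cases
    case 1
    \<comment> \<open>The budget here is 0.1875 for the upper tail and 0.1 for the lower.\<close>
    have "?U \<le> (1 - 0.75) / (1 + (2 / 3) / 2)"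
      by (rule upper[OF _ _ std_normal_cdf_lower_bounds(2) inv])
        (use s 1 in \<open>auto simp: power2_eq_square\<close>)
    moreover have "?L \<le> 2 * (1 - 0.95)"
    proof -
      \<comment> \<open>From \<open>s \<ge> 2 / 3\<close>:
        \<open>1 - s \<le> 1 / 3 < 1 / 1.7^2\<close>.\<close>
      have "sqrt (1 - s) \<le> 1 / 1.7"
        using s 1 by (intro real_le_lsqrt) (auto simp: power2_eq_square)
      then have "1.7 \<le> 1 / sqrt (1 - s)"
        using 1 by (simp add: field_simps)
      then have "0.95 \<le> std_normal_cdf (1 / sqrt (1 - s))"
        using std_normal_cdf_mono[of "1.7" "1 / sqrt (1 - s)"] std_normal_cdf_lower_bounds(3) by linarith
      moreover have "ig_arg s (-1) = - (1 / sqrt (1 - s))"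
        by (simp add: ig_arg_def)
      ultimately show ?thesis
        using integral_ig_std_lower_tail_le[of s] s 1 std_normal_cdf_uminus[of "1 / sqrt (1 - s)"]
        by simp
    qed
    ultimately show ?thesis by simp
  next
    case 2
    have "?U \<le> (1 - 0.7) / (1 + 1 / 2)"
      by (rule upper[OF _ _ std_normal_cdf_lower_bounds(1) inv])
        (use s 2 in \<open>auto simp: power2_eq_square\<close>)
    then show ?thesis
      using integral_ig_std_lower_tail_eq_0[of s] 2 by simp
  next
    case 3
    have "?U \<le> (1 - 1 / 2) / (1 + 2 / 2)"
      by (rule upper[where x = 0]) (use 3 in \<open>auto simp: std_normal_cdf_0\<close>)
    then show ?thesis
      using integral_ig_std_lower_tail_eq_0[of s] 3 by simp
  qed
  then show ?thesis
    using ig_prob_eq_tails[OF _ one] s std_normal_cdf_1_bounds(2) by simp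
qed

lemma ig_prob_gt:
  assumes "0 < s" and "(\<integral>z. ig_std s z \<partial>lborel) = 1"
  shows "ig_prob s > 2 * std_normal_cdf 1 - 1"
  using ig_prob_gt_small[of s] ig_prob_gt_large[of s] assms by linarith

section \<open>The limit as \<open>s\<close> tends to 0\<close>

lemma ig_prob_tendsto: "(\<lambda>n. ig_prob (1 / real (n + 2))) \<longlonglongrightarrow> 2 * std_normal_cdf 1 - 1"
  unfolding ig_prob_def std_normal_prob[symmetric]
\<comment> \<open>The shift by 2 keeps \<open>s \<le> 1 / 2\<close>, so
  \<open>t = 1 + s * z \<ge> 1 / 2\<close> on the interval. With \<open>sqrt t \<ge> 1 / 2\<close>
  and the normal density at most 1, the constant 4 dominates.\<close>
proof (rule integral_dominated_convergence[where w = "\<lambda>z. indicator {-1..1} z * 4"])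
  show "integrable lborel (\<lambda>z::real. indicat_real {-1..1} z * 4)"
    by (intro integrable_mult_left integrable_real_indicator) auto
  show "AE z in lborel. (\<lambda>n. indicator {-1..1} z * ig_std (1 / real (n + 2)) z)
      \<longlonglongrightarrow> indicator {-1..1} z * std_normal_density z"
  proof (intro AE_I2 tendsto_mult tendsto_const)
    fix z :: real
    let ?s = "\<lambda>n. 1 / real (n + 2)"
    have s: "?s \<longlonglongrightarrow> 0" by real_asymp
    have t: "(\<lambda>n. 1 + ?s n * z) \<longlonglongrightarrow> 1 + 0 * z"
      by (intro tendsto_intros s)
    then have "\<forall>\<^sub>F n in sequentially. 1 + ?s n * z > 0"
      by (rule order_tendstoD) simp
    then have ev: "\<forall>\<^sub>F n in sequentially. ig_std (?s n) z =
        std_normal_density (z / sqrt (1 + ?s n * z)) / ((1 + ?s n * z) * sqrt (1 + ?s n * z))"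
      by eventually_elim (simp add: ig_std_def ig_arg_def)
    have "(\<lambda>n. z / sqrt (1 + ?s n * z)) \<longlonglongrightarrow> z / sqrt (1 + 0 * z)"
      by (intro tendsto_divide tendsto_const tendsto_real_sqrt t) simp
    then have "(\<lambda>n. std_normal_density (z / sqrt (1 + ?s n * z))) \<longlonglongrightarrow> std_normal_density (z / sqrt (1 + 0 * z))"
      by (rule isCont_tendsto_compose[OF isCont_std_normal_density])
    then have "(\<lambda>n. std_normal_density (z / sqrt (1 + ?s n * z)) / ((1 + ?s n * z) * sqrt (1 + ?s n * z)))
        \<longlonglongrightarrow> std_normal_density (z / sqrt (1 + 0 * z)) / ((1 + 0 * z) * sqrt (1 + 0 * z))"
      by (intro tendsto_divide tendsto_mult tendsto_real_sqrt t) simp_all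
    then show "(\<lambda>n. ig_std (?s n) z) \<longlonglongrightarrow> std_normal_density z"
      by (subst tendsto_cong[OF ev]) simp
  qed
  show "AE z in lborel. norm (indicator {-1..1} z * ig_std (1 / real (n + 2)) z) \<le> indicator {-1..1} z * 4" for n
  proof (rule AE_I2)
    fix z :: real
    have "ig_std (1 / real (n + 2)) z \<le> 4" if z: "\<bar>z\<bar> \<le> 1"
    proof -
      define t where "t = 1 + 1 / real (n + 2) * z"
      have "\<bar>1 / real (n + 2) * z\<bar> \<le> 1 / 2 * 1"
        unfolding abs_mult using z by (intro mult_mono) auto
      then have t: "1 / 2 \<le> t" unfolding t_def by linarith
      have "1 / 2 \<le> sqrt t" using t by (intro real_le_rsqrt) (simp add: power2_eq_square)
      then have "1 / 2 * (1 / 2) \<le> t * sqrt t" using t by (intro mult_mono) auto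
      moreover have "std_normal_density (ig_arg (1 / real (n + 2)) z) \<le> 1"
      proof -
        have "std_normal_density (ig_arg (1 / real (n + 2)) z) \<le> std_normal_density 0"
          by (rule std_normal_density_le) simp
        also have "\<dots> \<le> 1"
          using pi_gt3 by (simp add: std_normal_density_def)
        finally show ?thesis .
      qed
      ultimately have "std_normal_density (ig_arg (1 / real (n + 2)) z) / (t * sqrt t) \<le> 1 / (1 / 2 * (1 / 2))"
        by (intro frac_le) auto
      then show ?thesis
        using t by (simp add: ig_std_def t_def)
    qed
    then show "norm (indicator {-1..1} z * ig_std (1 / real (n + 2)) z) \<le> indicator {-1..1} z * 4"
      using ig_std_nonneg[of "1 / real (n + 2)" z] by (auto simp: indicator_def)
  qed
qed auto

section \<open>Inverse Gaussian random variables\<close>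

text \<open>Change of variables \<open>x = \<mu> + \<mu> * s * z\<close> with Jacobian
  \<open>\<mu> * s\<close>; substituting \<open>lam = \<mu> / s^2\<close> cancels every remaining
  \<open>\<mu>\<close>.\<close>

lemma inverse_gaussian_density_affine:
  assumes pos: "\<mu> > 0" "lam > 0"
  defines "s \<equiv> sqrt (\<mu> / lam)"
  shows "\<mu> * s * inverse_gaussian_density \<mu> lam (\<mu> + \<mu> * s * z) = ig_std s z"
proof -
  have s: "s > 0" and lam: "lam = \<mu> / s\<^sup>2"
    using pos by (auto simp: s_def)
  have x: "\<mu> + \<mu> * s * z = \<mu> * (1 + s * z)"
    by (simp add: algebra_simps)
  show ?thesis
  proof (cases "1 + s * z > 0")
    case True
    define t where "t = 1 + s * z"
    have t: "t > 0" using True by (simp add: t_def)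
    have norm: "sqrt (lam / (2 * pi * (\<mu> * t) ^ 3)) = 1 / (\<mu> * s * (t * sqrt t) * sqrt (2 * pi))"
    proof (rule real_sqrt_unique)
      show "(1 / (\<mu> * s * (t * sqrt t) * sqrt (2 * pi)))\<^sup>2 = lam / (2 * pi * (\<mu> * t) ^ 3)"
        using pos s t by (simp add: lam power_mult_distrib power_divide field_simps eval_nat_numeral)
    qed (use pos s t in auto)
    have expo: "lam * (\<mu> * t - \<mu>)\<^sup>2 / (2 * \<mu>\<^sup>2 * (\<mu> * t)) = (ig_arg s z)\<^sup>2 / 2"
    proof -
      have "\<mu> * t - \<mu> = \<mu> * s * z"
        by (simp add: t_def algebra_simps)
      moreover have "(ig_arg s z)\<^sup>2 = z\<^sup>2 / t"
        using t by (simp add: ig_arg_def t_def[symmetric] power_divide)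
      ultimately show ?thesis
        using pos s t by (simp add: lam power_mult_distrib power2_eq_square)
    qed
    have "inverse_gaussian_density \<mu> lam (\<mu> * t) =
        1 / (\<mu> * s * (t * sqrt t) * sqrt (2 * pi)) * exp (- ((ig_arg s z)\<^sup>2 / 2))"
      unfolding inverse_gaussian_density_def norm expo using pos t by simp
    then show ?thesis
      using pos s t unfolding x
      by (simp add: ig_std_def t_def[symmetric] std_normal_density_def)
  next
    case False
    then show ?thesis
      using pos unfolding x
      by (simp add: inverse_gaussian_density_def ig_std_def zero_less_mult_iff)
  qed
qed

lemma inverse_gaussian_density_nonneg: "lam > 0 \<Longrightarrow> inverse_gaussian_density \<mu> lam x \<ge> 0"
  by (simp add: inverse_gaussian_density_def)

lemma (in prob_space) inverse_gaussian_standardized: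
  assumes pos: "\<mu> > 0" "lam > 0"
    and X: "distributed M lborel X (\<lambda>x. ennreal (inverse_gaussian_density \<mu> lam x))"
  defines "s \<equiv> sqrt (\<mu> / lam)"
  shows "distributed M lborel (\<lambda>\<omega>. (X \<omega> - \<mu>) / (\<mu> * s)) (\<lambda>z. ennreal (ig_std s z))"
proof -
  have s: "s > 0" using pos by (simp add: s_def)
  have eq1: "(\<lambda>\<omega>. - 1 / s + 1 / (\<mu> * s) * X \<omega>) = (\<lambda>\<omega>. (X \<omega> - \<mu>) / (\<mu> * s))"
    using pos s by (auto simp: field_simps)
  have eq2: "ennreal (inverse_gaussian_density \<mu> lam ((x - - 1 / s) / (1 / (\<mu> * s)))) / ennreal \<bar>1 / (\<mu> * s)\<bar>
      = ennreal (ig_std s x)" for x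
  proof -
    have "(x - - 1 / s) / (1 / (\<mu> * s)) = \<mu> + \<mu> * s * x"
      using pos s by (simp add: field_simps)
    then show ?thesis
      using pos s inverse_gaussian_density_affine[OF pos, of x]
      by (simp add: divide_ennreal inverse_gaussian_density_nonneg s_def[symmetric] mult.commute)
  qed
  have "1 / (\<mu> * s) \<noteq> 0" using pos s by simp
  from distributed_affine[OF X this, of "- 1 / s"] show ?thesis
    unfolding eq1 eq2 .
qed

text \<open>Mass 1 is read off from \<open>X\<close> being distributed with this density on a
  probability space. The moment lemmas, which assume it, give the standardized variable mean 0 and
  variance 1, so \<open>X\<close> has mean \<open>\<mu>\<close> and standard deviation
  \<open>\<mu> * s\<close>.\<close>

lemma (in prob_space) inverse_gaussian_one_sigma:
  assumes pos: "\<mu> > 0" "lam > 0"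
    and X: "distributed M lborel X (\<lambda>x. ennreal (inverse_gaussian_density \<mu> lam x))"
  defines "s \<equiv> sqrt (\<mu> / lam)"
  shows "(\<integral>z. ig_std s z \<partial>lborel) = 1"
    and "\<P>(\<omega> in M. \<bar>X \<omega> - expectation X\<bar> \<le> sqrt (variance X)) = ig_prob s"
proof -
  have s: "s > 0" using pos by (simp add: s_def)
  define Y where "Y = (\<lambda>\<omega>. (X \<omega> - \<mu>) / (\<mu> * s))"
  have Y: "distributed M lborel Y (\<lambda>z. ennreal (ig_std s z))"
    unfolding Y_def s_def by (rule inverse_gaussian_standardized[OF pos X])
  have XY: "X = (\<lambda>\<omega>. \<mu> + \<mu> * s * Y \<omega>)"
    using pos s by (auto simp: Y_def)
  note integral = distributed_integral[OF Y _ ig_std_nonneg]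
  show one: "(\<integral>z. ig_std s z \<partial>lborel) = 1"
    using integral[of "\<lambda>_. 1"] prob_space by simp
  have "integrable M Y"
    using distributed_integrable[OF Y _ ig_std_nonneg, of "\<lambda>z. z"] integrable_ig_std(2)[OF s]
    by (simp add: mult.commute)
  moreover have "expectation Y = 0"
    using integral[of "\<lambda>z. z"] integral_ig_std_first_moment[OF s one] by (simp add: mult.commute)
  ultimately have EX: "expectation X = \<mu>"
    unfolding XY by (simp add: prob_space)
  have "expectation (\<lambda>\<omega>. (Y \<omega>)\<^sup>2) = 1"
    using integral[of "\<lambda>z. z\<^sup>2"] integral_ig_std_second_moment[OF s one] by (simp add: mult.commute)
  then have "variance X = (\<mu> * s)\<^sup>2"
    unfolding EX unfolding XY by (simp add: power_mult_distrib)
  then have "\<P>(\<omega> in M. \<bar>X \<omega> - expectation X\<bar> \<le> sqrt (variance X)) = \<P>(\<omega> in M. \<bar>\<mu> * s * Y \<omega>\<bar> \<le> \<mu> * s * 1)"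
    unfolding EX using pos s by (simp add: XY)
  also have "\<dots> = measure M (Y -` {-1..1} \<inter> space M)"
    unfolding abs_mult using pos s
    by (intro arg_cong[where f = "measure M"]) (auto simp: abs_le_iff)
  also have "\<dots> = (\<integral>\<omega>. indicator {-1..1} (Y \<omega>) \<partial>M)"
  proof -
    have "Y -` {-1..1} \<inter> space M \<in> events"
      using distributed_measurable[OF Y] by measurable
    then have "measure M (Y -` {-1..1} \<inter> space M) = (\<integral>\<omega>. indicator (Y -` {-1..1} \<inter> space M) \<omega> \<partial>M)"
      by simp
    also have "\<dots> = (\<integral>\<omega>. indicator {-1..1} (Y \<omega>) \<partial>M)"
      by (intro Bochner_Integration.integral_cong) (auto simp: indicator_def)
    finally show ?thesis .
  qed
  also have "\<dots> = ig_prob s"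
    using integral[of "indicator {-1..1}"] by (simp add: ig_prob_def mult.commute)
  finally show "\<P>(\<omega> in M. \<bar>X \<omega> - expectation X\<bar> \<le> sqrt (variance X)) = ig_prob s" .
qed

lemma std_normal_one_sigma:
  assumes "prob_space N" and Z: "distributed N lborel Z (\<lambda>x. ennreal (std_normal_density x))"
  shows "\<P>(\<omega> in N. \<bar>Z \<omega>\<bar> \<le> 1) = 2 * std_normal_cdf 1 - 1"
proof -
  interpret prob_space N by fact
  have "\<P>(\<omega> in N. \<bar>Z \<omega>\<bar> \<le> 1) = measure N (Z -` {-1..1} \<inter> space N)"
    by (intro arg_cong[where f = "measure N"]) (auto simp: abs_le_iff)
  also have "\<dots> = measure (distr N lborel Z) {-1..1}"
    using distributed_measurable[OF Z] by (simp add: measure_distr)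
  also have "\<dots> = measure std_normal_distribution {-1..1}"
    by (simp add: distributed_distr_eq_density[OF Z])
  also have "\<dots> = 2 * std_normal_cdf 1 - 1"
    by (simp add: measure_std_normal_distribution std_normal_prob)
  finally show ?thesis .
qed

lemma round_decimals_eqI:
  assumes "\<bar>10 ^ d * x - of_int k\<bar> < 1 / 2"
  shows "round_decimals d x = of_int k / 10 ^ d"
  unfolding round_decimals_def using round_unique'[OF assms] by simp

theorem theorem6p1:
  fixes M :: "real \<Rightarrow> real \<Rightarrow> 'a measure" and X :: "real \<Rightarrow> real \<Rightarrow> 'a \<Rightarrow> real"
    and N :: "'b measure" and Z :: "'b \<Rightarrow> real"
  assumes prob_M: "\<And>\<mu> lam. \<mu> > 0 \<Longrightarrow> lam > 0 \<Longrightarrow> prob_space (M \<mu> lam)"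
    and X: "\<And>\<mu> lam. \<mu> > 0 \<Longrightarrow> lam > 0 \<Longrightarrow>
          distributed (M \<mu> lam) lborel (X \<mu> lam) (\<lambda>x. ennreal (inverse_gaussian_density \<mu> lam x))"
    and prob_N: "prob_space N"
    and Z: "distributed N lborel Z (\<lambda>x. ennreal (std_normal_density x))"
  shows "(\<forall>\<mu>>0. \<forall>lam>0.
            \<P>(\<omega> in M \<mu> lam. \<bar>X \<mu> lam \<omega> - prob_space.expectation (M \<mu> lam) (X \<mu> lam)\<bar>
                            \<le> sqrt (prob_space.variance (M \<mu> lam) (X \<mu> lam)))
              > \<P>(\<omega> in N. \<bar>Z \<omega>\<bar> \<le> 1))
       \<and> round_decimals 4 (\<P>(\<omega> in N. \<bar>Z \<omega>\<bar> \<le> 1)) = 0.6827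
       \<and> (INF (\<mu>, lam) \<in> {0<..} \<times> {0<..}.
            \<P>(\<omega> in M \<mu> lam. \<bar>X \<mu> lam \<omega> - prob_space.expectation (M \<mu> lam) (X \<mu> lam)\<bar>
                            \<le> sqrt (prob_space.variance (M \<mu> lam) (X \<mu> lam))))
          = \<P>(\<omega> in N. \<bar>Z \<omega>\<bar> \<le> 1)"
proof -
  define P where "P = (\<lambda>\<mu> lam. \<P>(\<omega> in M \<mu> lam. \<bar>X \<mu> lam \<omega> - prob_space.expectation (M \<mu> lam) (X \<mu> lam)\<bar>
                            \<le> sqrt (prob_space.variance (M \<mu> lam) (X \<mu> lam))))"
  let ?p = "2 * std_normal_cdf 1 - 1"
  have P_eq: "P \<mu> lam = ig_prob (sqrt (\<mu> / lam))" if "\<mu> > 0" "lam > 0" for \<mu> lam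
    unfolding P_def using prob_space.inverse_gaussian_one_sigma(2)[OF prob_M _ _ X] that by simp
  have P_gt: "P \<mu> lam > ?p" if "\<mu> > 0" "lam > 0" for \<mu> lam
    using that ig_prob_gt[OF _ prob_space.inverse_gaussian_one_sigma(1)[OF prob_M _ _ X]]
    by (simp add: P_eq)
  have "\<bar>10 ^ 4 * ?p - of_int 6827\<bar> < 1 / 2"
    using std_normal_cdf_1_bounds by (simp only: abs_less_iff) simp
  from round_decimals_eqI[OF this] have round: "round_decimals 4 ?p = 0.6827"
    by simp
  have inf: "(INF (\<mu>, lam) \<in> {0<..} \<times> {0<..}. P \<mu> lam) = ?p"
  proof (rule antisym)
    show "?p \<le> (INF (\<mu>, lam) \<in> {0<..} \<times> {0<..}. P \<mu> lam)"
      by (rule cINF_greatest) (auto intro!: less_imp_le P_gt)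
    show "(INF (\<mu>, lam) \<in> {0<..} \<times> {0<..}. P \<mu> lam) \<le> ?p"
    proof (rule LIMSEQ_le_const[OF ig_prob_tendsto], intro exI allI impI)
      fix n :: nat
      let ?s = "1 / real (n + 2)"
      \<comment> \<open>The real infimum is only conditionally complete, so boundedness must be
        supplied; the strict lower bound provides it.\<close>
      have "bdd_below ((\<lambda>(\<mu>, lam). P \<mu> lam) ` ({0<..} \<times> {0<..}))"
        by (rule bdd_belowI2[of _ ?p]) (auto intro!: less_imp_le P_gt)
      \<comment> \<open>With \<open>\<mu> = ?s^2\<close> and \<open>lam = 1\<close> the parameter
        \<open>sqrt (\<mu> / lam)\<close> is exactly \<open>?s\<close>.\<close>
      from cINF_lower[OF this, of "(?s\<^sup>2, 1)"]
      show "(INF (\<mu>, lam) \<in> {0<..} \<times> {0<..}. P \<mu> lam) \<le> ig_prob ?s"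
        using P_eq[of "?s\<^sup>2" 1] by (simp add: real_sqrt_divide)
    qed
  qed
  show ?thesis
    unfolding P_def[symmetric] std_normal_one_sigma[OF prob_N Z]
    using P_gt round inf by (simp add: P_def)
qed

end
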